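(* Let $\sigma$ be the function on finite disjoint unions of paths defined below (the misère selective outcome function). For every $n\ge 0$: 1. $\sigma(P_{7n+1})=\sigma(P_{7n+2})=0$; 2. $\sigma(P_{7n+a})=1$ for every $a$ with $3\le a\le 7$.
   Context: For $n\ge 0$, $P_n$ denotes the path on $n$ vertices ($P_0$ is the empty graph). A Node-Kayles move on a path $P_k$ with $k\ge 1$ chooses a vertex and deletes it together with its neighbours. The set $O(P_k)$ of options of $P_k$ is: $O(P_0)=\emptyset$; $O(P_1)=O(P_2)=\{P_0\}$; $O(P_3)=\{P_0,P_1\}$; and, for $k\ge 4$, $$O(P_k)=\{P_{k-2},P_{k-3}\}\cup\{P_i\cup P_j:\ j\ge i\ge 1,\ i+j=k-3\}.$$ The function $\sigma$, which records the outcome for selective compound Node-Kayles under misère play with $1$ meaning $\mathcal{N}$ and $0$ meaning $\mathcal{P}$, is the Boolean function defined recursively by: - $\sigma(P_0)=1$; - $\sigma(P_k)=1-\min\{\sigma(G'):G'\in O(P_k)\}$ for $k\ge1$; - $\sigma(P_i\cup P_j)=\sigma(P_i)\vee\sigma(P_j)$ (Boolean OR) for nonempty paths $P_i,P_j$. *)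

theory Defs
  imports "HOL-Library.Multiset"
begin

text \<open>
  A finite disjoint union of paths is the multiset of the numbers of vertices of its
  (nonempty) components, so that disjoint union is multiset sum and the empty graph is the
  empty multiset. Multisets containing 0 do not represent positions.
\<close>

type_synonym position = "nat multiset"

definition path :: "nat \<Rightarrow> position" where
  "path k = (if k = 0 then {#} else {#k#})"

definition options :: "nat \<Rightarrow> position set" where
  "options k =
    (if k = 0 then {}
     else if k \<le> 2 then {path 0}
     else if k = 3 then {path 0, path 1}
     else {path (k - 2), path (k - 3)} \<union>
       {path i + path j | i j. 1 \<le> i \<and> i \<le> j \<and> i + j = k - 3})"

lemma options_sum_less: "G \<in> options k \<Longrightarrow> sum_mset G < k"
  by (auto simp: options_def path_def split: if_splits)

lemma options_finite: "finite (options k)"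
proof -
  have "{path i + path j | i j. 1 \<le> i \<and> i \<le> j \<and> i + j = k - 3}
      \<subseteq> (\<lambda>(i, j). path i + path j) ` ({..k} \<times> {..k})"
    by force
  then have "finite {path i + path j | i j. 1 \<le> i \<and> i \<le> j \<and> i + j = k - 3}"
    by (rule finite_subset) simp
  then show ?thesis
    by (simp add: options_def)
qed

lemma options_nonempty: "k \<ge> 1 \<Longrightarrow> options k \<noteq> {}"
  by (simp add: options_def)

text \<open>
  Outcomes are the numbers 1 (next player wins) and 0 (previous player wins). The last branch
  is the iterated form of the rule for a union of two paths; the characteristic equations are
  \<open>sigma_empty\<close>, \<open>sigma_path\<close> and \<open>sigma_union\<close> below.
\<close>

function sigma :: "position \<Rightarrow> nat" where
  "sigma G =
    (if G = {#} then 1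
     else if size G = 1 then 1 - Min (sigma ` options (the_elem (set_mset G)))
     else of_bool (\<exists>k\<in>set_mset G. sigma {#k#} = 1))"
  by auto
termination
proof (relation "measures [sum_mset, size]")
  fix G H :: position
  assume "size G = 1" and H: "H \<in> options (the_elem (set_mset G))"
  then obtain k where "G = {#k#}"
    using size_1_singleton_mset by blast
  then show "(H, G) \<in> measures [sum_mset, size]"
    using options_sum_less[of H k] H by simp
next
  fix G :: position and k
  assume G: "G \<noteq> {#}" "size G \<noteq> 1" and "k \<in># G"
  then obtain M where M: "G = add_mset k M"
    by (meson mset_add)
  then have "size M \<noteq> 0"
    using G by auto
  then show "({#k#}, G) \<in> measures [sum_mset, size]"
    using M by (auto simp: nonempty_has_size)
qed simp

declare sigma.simps [simp del]

lemma sigma_empty: "sigma (path 0) = 1"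
  by (simp add: sigma.simps path_def)

lemma sigma_path: "k \<ge> 1 \<Longrightarrow> sigma (path k) = 1 - Min (sigma ` options k)"
  by (subst sigma.simps) (simp add: path_def)

lemma sigma_Boolean: "sigma G \<in> {0, 1}"
  by (subst sigma.simps) auto

lemma sigma_eq_components:
  assumes "G \<noteq> {#}"
  shows "sigma G = of_bool (\<exists>k\<in>set_mset G. sigma {#k#} = 1)"
proof (cases "size G = 1")
  case True
  then obtain k where "G = {#k#}"
    using size_1_singleton_mset by blast
  then show ?thesis
    using sigma_Boolean[of G] by auto
next
  case False
  then show ?thesis
    using assms by (subst sigma.simps) simp
qed

lemma sigma_union:
  assumes "G \<noteq> {#}" and "H \<noteq> {#}"
  shows "sigma (G + H) = of_bool (sigma G = 1 \<or> sigma H = 1)"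
proof -
  have "G + H \<noteq> {#}"
    using assms by simp
  then show ?thesis
    using assms by (auto simp: sigma_eq_components[of "G + H"]
        sigma_eq_components[of G] sigma_eq_components[of H])
qed

end

theory Submission
  imports Defs
begin

text \<open>
  A path is a P-position iff its number of vertices is 1 or 2 modulo 7. Sums of two of these
  residues are 2, 3 or 4, so a move to a union of two P-paths exists only from 5, 6 or 7 modulo 7,
  while a move to a single P-path exists only from 3, 4 or 5 modulo 7.
\<close>

text \<open>Values are naturals, so the truncated difference \<open>1 - Min\<close> vanishes exactly
  when the minimum is positive. This is the usual rule that a P-position has no P-option.\<close>

lemma sigma_path_eq_0_iff:
  assumes "k \<ge> 1"
  shows "sigma (path k) = 0 \<longleftrightarrow> (\<forall>G\<in>options k. sigma G \<noteq> 0)"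
proof -
  let ?S = "sigma ` options k"
  have S: "finite ?S" "?S \<noteq> {}"
    using options_finite options_nonempty[OF assms] by auto
  have "sigma (path k) = 0 \<longleftrightarrow> 1 \<le> Min ?S"
    using sigma_path[OF assms] by auto
  also have "\<dots> \<longleftrightarrow> (\<forall>G\<in>options k. sigma G \<noteq> 0)"
    using S by (auto simp: Suc_le_eq)
  finally show ?thesis .
qed

lemma sigma_path_union_eq_0_iff:
  assumes "i \<ge> 1" "j \<ge> 1"
  shows "sigma (path i + path j) = 0 \<longleftrightarrow> sigma (path i) = 0 \<and> sigma (path j) = 0"
  using assms sigma_union[of "path i" "path j"] sigma_Boolean[of "path i"] sigma_Boolean[of "path j"]
  by (auto simp: path_def)

text \<open>Writing the length as \<open>m + 3\<close> removes the truncated subtractions from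
  \<open>options\<close>, and \<open>m \<ge> 1\<close> selects its generic clause. Since a union
  takes the OR of its components, it is a P-position only if both of them are.\<close>

lemma sigma_path_add_3_eq_0_iff:
  assumes "m \<ge> 1"
  shows "sigma (path (m + 3)) = 0 \<longleftrightarrow> sigma (path (m + 1)) \<noteq> 0 \<and> sigma (path m) \<noteq> 0 \<and>
    (\<forall>i j. 1 \<le> i \<longrightarrow> i \<le> j \<longrightarrow> i + j = m \<longrightarrow> \<not> (sigma (path i) = 0 \<and> sigma (path j) = 0))"
proof -
  have "options (m + 3) = {path (m + 1), path m} \<union>
      {path i + path j | i j. 1 \<le> i \<and> i \<le> j \<and> i + j = m}"
    using assms by (simp add: options_def)
  then have "sigma (path (m + 3)) = 0 \<longleftrightarrow> sigma (path (m + 1)) \<noteq> 0 \<and> sigma (path m) \<noteq> 0 \<and>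
      (\<forall>i j. 1 \<le> i \<longrightarrow> i \<le> j \<longrightarrow> i + j = m \<longrightarrow> sigma (path i + path j) \<noteq> 0)"
    using sigma_path_eq_0_iff[of "m + 3"] by auto
  moreover have "sigma (path i + path j) = 0 \<longleftrightarrow> sigma (path i) = 0 \<and> sigma (path j) = 0"
    if "1 \<le> i" "i \<le> j" for i j
    using that by (intro sigma_path_union_eq_0_iff) auto
  ultimately show ?thesis
    by auto
qed

text \<open>Strong induction on the length. The equivalence supplies both directions needed: short
  P-paths to move to, and the absence of any others.\<close>

lemma sigma_path_eq_0_iff_mod_7: "sigma (path k) = 0 \<longleftrightarrow> k mod 7 = 1 \<or> k mod 7 = 2"
proof (induction k rule: less_induct)
  case (less k)
  consider "k = 0" | "k = 1 \<or> k = 2" | "k = 3" | "k \<ge> 4"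
    by linarith
  then show ?case
  proof cases
    case 1
    then show ?thesis
      by (simp add: sigma_empty)
  next
    case 2
    then have "options k = {path 0}"
      by (auto simp: options_def)
    then show ?thesis
      using 2 sigma_path_eq_0_iff[of k] sigma_empty by auto
  next
    case 3
    then have "options k = {path 0, path 1}"
      by (simp add: options_def)
    then show ?thesis
      using 3 sigma_path_eq_0_iff[of k] less.IH[of 1] by simp
  next
    case 4
    define m where "m = k - 3"
    then have k: "k = m + 3" "m \<ge> 1"
      using 4 by auto
    \<comment> \<open>With the residue condition named \<open>Z\<close>, the induction hypothesis
      turns the recursion into pure arithmetic modulo 7.\<close>
    define Z :: "nat \<Rightarrow> bool" where "Z x \<longleftrightarrow> x mod 7 = 1 \<or> x mod 7 = 2" for x
    have IH: "sigma (path x) = 0 \<longleftrightarrow> Z x" if "x < k" for x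
      using less.IH[OF that] by (simp add: Z_def)
    have "sigma (path k) = 0 \<longleftrightarrow> \<not> Z (m + 1) \<and> \<not> Z m \<and>
        (\<forall>i j. 1 \<le> i \<longrightarrow> i \<le> j \<longrightarrow> i + j = m \<longrightarrow> \<not> (Z i \<and> Z j))"
      unfolding k sigma_path_add_3_eq_0_iff[OF k(2)] using IH k by auto
    also have "\<dots> \<longleftrightarrow> Z k"
    proof -
      have k_mod: "k mod 7 = (m mod 7 + 3) mod 7" and m1_mod: "(m + 1) mod 7 = (m mod 7 + 1) mod 7"
        unfolding k by (simp_all add: mod_simps)
      have m: "m = 7 * (m div 7) + m mod 7"
        by simp
      \<comment> \<open>The longer component in the two splittings below. Its residue is 2 rather
        than 1 so that it is at least as long as a companion of 1 or 2 vertices even when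
        \<open>m div 7 = 0\<close>.\<close>
      have Z_j: "Z (7 * (m div 7) + 2)"
        unfolding Z_def mod_mult_self4 by simp
      have "m mod 7 < 7"
        by simp
      then consider "m mod 7 \<in> {0, 1, 2}" | "m mod 7 = 3" | "m mod 7 = 4" | "m mod 7 \<in> {5, 6}"
        by force
      then show ?thesis
      proof cases
        case 1
        \<comment> \<open>Residue 0 makes \<open>m + 1\<close> a P-length; residues 1 and 2 make
          \<open>m\<close> itself one.\<close>
        then have "Z (m + 1) \<or> Z m" "\<not> Z k"
          unfolding Z_def k_mod m1_mod by auto
        then show ?thesis
          by blast
      next
        case 2
        \<comment> \<open>Here \<open>k\<close> has residue 6, and a move leaves two P-paths, the
          shorter being a single vertex.\<close>
        then have "m = 1 + (7 * (m div 7) + 2)"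
          using m by linarith
        moreover have "Z 1" "\<not> Z k"
          using 2 unfolding Z_def k_mod by simp_all
        ultimately show ?thesis
          using Z_j by (metis le_add2 one_le_numeral order_trans order_refl)
      next
        case 3
        \<comment> \<open>Here \<open>k\<close> is divisible by 7, and the shorter P-path has two
          vertices.\<close>
        then have "m = 2 + (7 * (m div 7) + 2)"
          using m by linarith
        moreover have "Z 2" "\<not> Z k"
          using 3 unfolding Z_def k_mod by simp_all
        ultimately show ?thesis
          using Z_j by (metis le_add2 one_le_numeral)
      next
        case 4
        \<comment> \<open>Two residues from {1, 2} add up to 2, 3 or 4, never to 5 or 6.\<close>
        have "\<not> (Z i \<and> Z j)" if "i + j = m" for i j
        proof -
          have "m mod 7 = (i mod 7 + j mod 7) mod 7"
            unfolding that[symmetric] by (simp add: mod_simps)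
          then show ?thesis
            using 4 unfolding Z_def by auto
        qed
        moreover have "\<not> Z (m + 1)" "\<not> Z m" "Z k"
          using 4 unfolding Z_def k_mod m1_mod by auto
        ultimately show ?thesis
          by blast
      qed
    qed
    finally show ?thesis
      by (simp add: Z_def)
  qed
qed

theorem theorem7:
  fixes n :: nat
  shows "sigma (path (7 * n + 1)) = 0 \<and> sigma (path (7 * n + 2)) = 0
    \<and> (\<forall>a::nat. 3 \<le> a \<and> a \<le> 7 \<longrightarrow> sigma (path (7 * n + a)) = 1)"
proof -
  have mod_7: "(7 * n + a) mod 7 = a mod 7" for a
    by simp
  have "sigma (path (7 * n + a)) = 1" if "3 \<le> a \<and> a \<le> 7" for a
  proof -
    \<comment> \<open>Listing the values lets each residue be computed; 7 is the one that wraps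
      around, to residue 0.\<close>
    have "a = 3 \<or> a = 4 \<or> a = 5 \<or> a = 6 \<or> a = 7"
      using that by linarith
    then have "sigma (path (7 * n + a)) \<noteq> 0"
      unfolding sigma_path_eq_0_iff_mod_7 mod_7 by auto
    then show ?thesis
      using sigma_Boolean[of "path (7 * n + a)"] by simp
  qed
  moreover have "sigma (path (7 * n + 1)) = 0" "sigma (path (7 * n + 2)) = 0"
    unfolding sigma_path_eq_0_iff_mod_7 mod_7 by simp_all
  ultimately show ?thesis
    by blast
qed

end
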